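(* Let $\Gamma$ be any group. For $r\ge1$ let $u_r(\Gamma)$ be the number of conjugacy classes of index $r$ subgroups of $\Gamma$ and let $j_r(\Gamma)$ be the number of index $r$ subgroups of $\Gamma$. Then for every $m\ge1$, $$j_m(\Gamma\times\mathbb Z)=\sum_{r\mid m}r\cdot u_r(\Gamma)=\sum_{r\mid m}\ \sum_{H\subset\Gamma,\ |\Gamma/H|=m/r}\bigl|\mathrm{Hom}(H_{\mathrm{ab}},\mathbb Z_r)\bigr|,$$ where $\mathbb Z_r=\mathbb Z/r\mathbb Z$, $H$ runs over all subgroups of $\Gamma$ of index $m/r$, and $H_{\mathrm{ab}}$ denotes the abelianization of $H$. *)

theory Defs
  imports "HOL-Algebra.Algebra"
begin

unbundle cardinal_syntax

text \<open>
  The group is arbitrary, so the sets being counted may be infinite. All numbers below are therefore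
  cardinals in the sense of the cardinal arithmetic of \<^theory>\<open>Main\<close>: \<open>|A|\<close> is the cardinality of \<open>A\<close>,
  \<open>=o\<close> is equality of cardinals (also across types), \<open>*c\<close> is multiplication and
  \<open>CSUM i : |I|. c i\<close> is the sum of the cardinals \<open>c i\<close> over \<open>i \<in> I\<close>.
  The natural number \<open>r\<close> is the cardinal \<open>|{..<r}|\<close>. (\<open>card\<close> would send infinite sets to 0.)
\<close>

text \<open>Only meaningful for \<open>r \<ge> 1\<close>: then \<open>card _ = r\<close> forces the set of cosets to be finite.\<close>

definition subgroups_of_index :: "('a, 'b) monoid_scheme \<Rightarrow> nat \<Rightarrow> 'a set set" where
  "subgroups_of_index G r = {H. subgroup H G \<and> card (rcosets\<^bsub>G\<^esub> H) = r}"

definition subgroup_conj_classes :: "('a, 'b) monoid_scheme \<Rightarrow> nat \<Rightarrow> 'a set set set" where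
  "subgroup_conj_classes G r =
     orbits G (subgroups_of_index G r) (\<lambda>g H. g <#\<^bsub>G\<^esub> H #>\<^bsub>G\<^esub> (inv\<^bsub>G\<^esub> g))"

definition num_subgroups :: "('a, 'b) monoid_scheme \<Rightarrow> nat \<Rightarrow> 'a set rel" where
  "num_subgroups G r = |subgroups_of_index G r|"

definition num_subgroup_classes :: "('a, 'b) monoid_scheme \<Rightarrow> nat \<Rightarrow> 'a set set rel" where
  "num_subgroup_classes G r = |subgroup_conj_classes G r|"

definition abelianization :: "('a, 'b) monoid_scheme \<Rightarrow> 'a set monoid" where
  "abelianization G = G Mod derived G (carrier G)"

text \<open>
  \<^const>\<open>hom\<close> does not constrain values outside the carrier, so it contains many functions
  for each homomorphism; the extensional ones represent each homomorphism exactly once.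
\<close>

definition Hom :: "('a, 'c) monoid_scheme \<Rightarrow> ('b, 'd) monoid_scheme \<Rightarrow> ('a \<Rightarrow> 'b) set" where
  "Hom G H = hom G H \<inter> extensional (carrier G)"

end

theory Submission
  imports Defs
begin

text \<open>
  Let \<open>K\<close> be a subgroup of index \<open>m\<close> in \<open>G \<times> \<int>\<close>. Reading \<open>K\<close> along either of the two projections
  describes it by data on \<open>G\<close> alone, and each reading gives one of the two formulas. In both, the index
  of \<open>K\<close> is the product of the index of its image in one factor and the index of its intersection with
  the other (\<open>card_rcosets_short_exact\<close>).

  Projecting to \<open>\<int>\<close>: the image of \<open>K\<close> is \<open>k\<int>\<close>, and \<open>N = {g. (g, 0) \<in> K}\<close> has index \<open>r = m / k\<close>. The
  elements of \<open>K\<close> over \<open>k\<close> form one coset \<open>N x\<close>, where \<open>x\<close> normalizes \<open>N\<close>, and \<open>K\<close> is generated by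
  \<open>N\<close> and \<open>(x, k)\<close>; conversely every such coset occurs (\<open>bij_betw_subgroups_fibres\<close>). Hence \<open>K\<close> amounts
  to a divisor \<open>r\<close>, a subgroup \<open>N\<close> of index \<open>r\<close>, and an element of the quotient of its normalizer by \<open>N\<close>.
  A conjugacy class of \<open>N\<close> has as many members as the normalizer has cosets, so over one class the
  pairs \<open>(N, N x)\<close> are as many as the cosets of one member, namely \<open>r\<close>
  (\<open>conj_class_normalizer_cosets\<close>). This gives \<open>r\<close> times the number of classes.

  Projecting to \<open>G\<close>: the image \<open>H\<close> of \<open>K\<close> has index \<open>m / r\<close>, where \<open>K\<close> meets \<open>\<int>\<close> in \<open>r\<int>\<close>. For
  \<open>h \<in> H\<close> the integers \<open>n\<close> with \<open>(h, n) \<in> K\<close> form one residue class modulo \<open>r\<close>, so \<open>K\<close> is the graph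
  of a homomorphism from \<open>H\<close> to \<open>\<int> / r\<int>\<close> (\<open>bij_betw_congruence_graph\<close>). As the target is abelian, these
  are the homomorphisms of the abelianization (\<open>bij_betw_Hom_abelianization\<close>).

  All comparisons are explicit bijections, so \<open>G\<close> may have infinitely many subgroups of a given index;
  only the cosets of a single subgroup of finite index are ever counted by a natural number.
\<close>

section \<open>Cardinals of disjoint unions\<close>

text \<open>
  For a set \<open>I\<close> partitioned into the blocks \<open>Q\<close>, with \<open>q i\<close> the block of \<open>i\<close>: a sum over \<open>I\<close> may be
  taken block by block.
\<close>
lemma bij_betw_Sigma_blocks:
  assumes "\<And>i. i \<in> I \<Longrightarrow> q i \<in> Q \<and> i \<in> q i"
    and "\<And>C i. C \<in> Q \<Longrightarrow> i \<in> C \<Longrightarrow> C = q i \<and> i \<in> I"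
  shows "bij_betw (\<lambda>(i, a). (q i, i, a)) (Sigma I A) (SIGMA C:Q. Sigma C A)"
  by (rule bij_betw_byWitness[where f' = snd]) (use assms in \<open>auto 0 4 dest: assms(2)\<close>)

lemma card_of_Sigma_cong1:
  assumes "\<And>i. i \<in> I \<Longrightarrow> |A i| =o |B i|"
  shows "|SIGMA i:I. A i| =o |SIGMA i:I. B i|"
  using assms card_of_Sigma_mono1[of I A B] card_of_Sigma_mono1[of I B A]
  by (simp add: ordIso_iff_ordLeq)


section \<open>Index along a short exact sequence\<close>

lemma (in group) rcos_eq_iff:
  assumes "subgroup H G" "x \<in> carrier G" "y \<in> carrier G"
  shows "H #> x = H #> y \<longleftrightarrow> x \<otimes> inv y \<in> H"
  using assms
  by (metis repr_independence rcos_self is_group subgroup.rcos_module)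

lemma (in group) mult_right_diff:
  assumes "x \<in> carrier G" "y \<in> carrier G" "z \<in> carrier G"
  shows "(x \<otimes> z) \<otimes> inv (y \<otimes> z) = x \<otimes> inv y"
proof -
  have "(x \<otimes> z) \<otimes> inv (y \<otimes> z) = x \<otimes> ((z \<otimes> inv z) \<otimes> inv y)"
    using assms by (simp only: inv_mult_group m_assoc m_closed inv_closed)
  then show ?thesis
    using assms by simp
qed

lemma (in group) mult_inv_cancel:
  assumes "x \<in> carrier G" "y \<in> carrier G"
  shows "x \<otimes> (inv x \<otimes> y) = y" "inv x \<otimes> (x \<otimes> y) = y"
  using assms by (simp_all flip: m_assoc)

text \<open>
  Every coset of \<open>K\<close> has the form \<open>K (\<iota> b) s\<close>, where \<open>s\<close> runs over fixed lifts of representatives of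
  the cosets of \<open>f(K)\<close> and \<open>b\<close> over representatives of the cosets of \<open>\<iota>\<inverse>(K)\<close>. The set of cosets
  is thus a product, and since \<^const>\<open>card\<close> is multiplicative on products even for infinite sets,
  no finiteness is involved.
\<close>
lemma card_rcosets_short_exact:
  assumes f: "group_hom D E f" and surj: "f ` carrier D = carrier E"
    and i: "group_hom F D i" and ker: "i ` carrier F = kernel D E f"
    and K: "subgroup K D"
  shows "card (rcosets\<^bsub>D\<^esub> K) =
    card (rcosets\<^bsub>E\<^esub> (f ` K)) * card (rcosets\<^bsub>F\<^esub> {x \<in> carrier F. i x \<in> K})"
proof -
  interpret f: group_hom D E f by (rule f)
  interpret i: group_hom F D i by (rule i)
  interpret K: subgroup K D by (rule K)
  define P where "P = f ` K"
  define Q where "Q = {x \<in> carrier F. i x \<in> K}"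
  have P: "subgroup P E"
    unfolding P_def by (rule f.subgroup_img_is_subgroup[OF K])
  have Q: "subgroup Q F"
    by (rule i.G.subgroupI) (auto simp: Q_def intro!: exI[of _ "\<one>\<^bsub>F\<^esub>"])
  have "\<exists>d. d \<in> carrier D \<and> P #>\<^bsub>E\<^esub> f d = A" if "A \<in> rcosets\<^bsub>E\<^esub> P" for A
  proof -
    obtain e where "e \<in> f ` carrier D" "A = P #>\<^bsub>E\<^esub> e"
      using \<open>A \<in> rcosets\<^bsub>E\<^esub> P\<close> surj by (auto simp: RCOSETS_def)
    then show ?thesis by auto
  qed
  then obtain s where s: "\<And>A. A \<in> rcosets\<^bsub>E\<^esub> P \<Longrightarrow> s A \<in> carrier D \<and> P #>\<^bsub>E\<^esub> f (s A) = A"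
    by metis
  have "\<exists>b. b \<in> carrier F \<and> Q #>\<^bsub>F\<^esub> b = B" if "B \<in> rcosets\<^bsub>F\<^esub> Q" for B
    using that by (auto simp: RCOSETS_def)
  then obtain t where t: "\<And>B. B \<in> rcosets\<^bsub>F\<^esub> Q \<Longrightarrow> t B \<in> carrier F \<and> Q #>\<^bsub>F\<^esub> t B = B"
    by metis
  have fi: "f (i x) = \<one>\<^bsub>E\<^esub>" if "x \<in> carrier F" for x
    using ker that by (auto simp: kernel_def)
  let ?h = "\<lambda>(A, B). K #>\<^bsub>D\<^esub> (i (t B) \<otimes>\<^bsub>D\<^esub> s A)"
  have "bij_betw ?h ((rcosets\<^bsub>E\<^esub> P) \<times> (rcosets\<^bsub>F\<^esub> Q)) (rcosets\<^bsub>D\<^esub> K)"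
  proof (rule bij_betw_imageI)
    show "inj_on ?h ((rcosets\<^bsub>E\<^esub> P) \<times> (rcosets\<^bsub>F\<^esub> Q))"
    proof (rule inj_onI, clarify)
      fix A B A' B'
      assume A: "A \<in> rcosets\<^bsub>E\<^esub> P" "A' \<in> rcosets\<^bsub>E\<^esub> P" and B: "B \<in> rcosets\<^bsub>F\<^esub> Q" "B' \<in> rcosets\<^bsub>F\<^esub> Q"
        and eq: "K #>\<^bsub>D\<^esub> (i (t B) \<otimes>\<^bsub>D\<^esub> s A) = K #>\<^bsub>D\<^esub> (i (t B') \<otimes>\<^bsub>D\<^esub> s A')"
      note mem = s[OF A(1)] s[OF A(2)] t[OF B(1)] t[OF B(2)]
      have in_K: "(i (t B) \<otimes>\<^bsub>D\<^esub> s A) \<otimes>\<^bsub>D\<^esub> inv\<^bsub>D\<^esub> (i (t B') \<otimes>\<^bsub>D\<^esub> s A') \<in> K"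
        using eq mem by (subst (asm) f.G.rcos_eq_iff[OF K]) auto
      have "f (s A) \<otimes>\<^bsub>E\<^esub> inv\<^bsub>E\<^esub> f (s A') = f ((i (t B) \<otimes>\<^bsub>D\<^esub> s A) \<otimes>\<^bsub>D\<^esub> inv\<^bsub>D\<^esub> (i (t B') \<otimes>\<^bsub>D\<^esub> s A'))"
        using mem by (simp add: fi)
      then have "f (s A) \<otimes>\<^bsub>E\<^esub> inv\<^bsub>E\<^esub> f (s A') \<in> P"
        using in_K by (simp add: P_def)
      then have "P #>\<^bsub>E\<^esub> f (s A) = P #>\<^bsub>E\<^esub> f (s A')"
        using mem by (subst f.H.rcos_eq_iff[OF P]) auto
      then have AA: "A = A'"
        using mem by metis
      have "(i (t B) \<otimes>\<^bsub>D\<^esub> s A) \<otimes>\<^bsub>D\<^esub> inv\<^bsub>D\<^esub> (i (t B') \<otimes>\<^bsub>D\<^esub> s A') = i (t B \<otimes>\<^bsub>F\<^esub> inv\<^bsub>F\<^esub> t B')"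
        using mem unfolding AA
        by (simp add: f.G.mult_right_diff)
      then have "t B \<otimes>\<^bsub>F\<^esub> inv\<^bsub>F\<^esub> t B' \<in> Q"
        using in_K mem by (simp add: Q_def)
      then have "Q #>\<^bsub>F\<^esub> t B = Q #>\<^bsub>F\<^esub> t B'"
        using mem by (subst i.G.rcos_eq_iff[OF Q]) auto
      then show "A = A' \<and> B = B'"
        using AA mem by metis
    qed
    show "?h ` ((rcosets\<^bsub>E\<^esub> P) \<times> (rcosets\<^bsub>F\<^esub> Q)) = rcosets\<^bsub>D\<^esub> K"
    proof
      show "?h ` ((rcosets\<^bsub>E\<^esub> P) \<times> (rcosets\<^bsub>F\<^esub> Q)) \<subseteq> rcosets\<^bsub>D\<^esub> K"
        using s t K.subset by (auto intro!: f.G.rcosetsI)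
      show "rcosets\<^bsub>D\<^esub> K \<subseteq> ?h ` ((rcosets\<^bsub>E\<^esub> P) \<times> (rcosets\<^bsub>F\<^esub> Q))"
      proof
        fix C assume "C \<in> rcosets\<^bsub>D\<^esub> K"
        then obtain d where d: "d \<in> carrier D" "C = K #>\<^bsub>D\<^esub> d"
          by (auto simp: RCOSETS_def)
        define A where "A = P #>\<^bsub>E\<^esub> f d"
        have A: "A \<in> rcosets\<^bsub>E\<^esub> P"
          unfolding A_def using d P by (auto intro!: f.H.rcosetsI dest: subgroup.subset)
        have sA: "s A \<in> carrier D" "P #>\<^bsub>E\<^esub> f d = P #>\<^bsub>E\<^esub> f (s A)"
          using s[OF A] A_def by auto
        then have "f d \<otimes>\<^bsub>E\<^esub> inv\<^bsub>E\<^esub> f (s A) \<in> P"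
          using d by (subst (asm) f.H.rcos_eq_iff[OF P]) auto
        then obtain k where k: "k \<in> K" "f d \<otimes>\<^bsub>E\<^esub> inv\<^bsub>E\<^esub> f (s A) = f k"
          by (auto simp: P_def)
        have kD: "k \<in> carrier D" using k by auto
        have "f (inv\<^bsub>D\<^esub> k \<otimes>\<^bsub>D\<^esub> (d \<otimes>\<^bsub>D\<^esub> inv\<^bsub>D\<^esub> s A)) = \<one>\<^bsub>E\<^esub>"
          using k(2) kD d sA(1) by simp
        then have "inv\<^bsub>D\<^esub> k \<otimes>\<^bsub>D\<^esub> (d \<otimes>\<^bsub>D\<^esub> inv\<^bsub>D\<^esub> s A) \<in> i ` carrier F"
          using kD d sA(1) unfolding ker kernel_def by auto
        then obtain x where x: "x \<in> carrier F" "i x = inv\<^bsub>D\<^esub> k \<otimes>\<^bsub>D\<^esub> (d \<otimes>\<^bsub>D\<^esub> inv\<^bsub>D\<^esub> s A)"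
          by force
        define B where "B = Q #>\<^bsub>F\<^esub> x"
        have B: "B \<in> rcosets\<^bsub>F\<^esub> Q"
          unfolding B_def using x Q by (auto intro!: i.G.rcosetsI dest: subgroup.subset)
        have tB: "t B \<in> carrier F" "Q #>\<^bsub>F\<^esub> x = Q #>\<^bsub>F\<^esub> t B"
          using t[OF B] B_def by auto
        then have "x \<otimes>\<^bsub>F\<^esub> inv\<^bsub>F\<^esub> t B \<in> Q"
          using x by (subst (asm) i.G.rcos_eq_iff[OF Q]) auto
        then have q: "i x \<otimes>\<^bsub>D\<^esub> inv\<^bsub>D\<^esub> i (t B) \<in> K"
          using x tB by (simp add: Q_def)
        have "d \<otimes>\<^bsub>D\<^esub> inv\<^bsub>D\<^esub> (i (t B) \<otimes>\<^bsub>D\<^esub> s A) = k \<otimes>\<^bsub>D\<^esub> (i x \<otimes>\<^bsub>D\<^esub> inv\<^bsub>D\<^esub> i (t B))"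
          using d kD sA(1) tB(1) unfolding x(2)
          by (simp add: f.G.inv_mult_group f.G.m_assoc f.G.mult_inv_cancel)
        also have "\<dots> \<in> K"
          using k q by simp
        finally have "C = K #>\<^bsub>D\<^esub> (i (t B) \<otimes>\<^bsub>D\<^esub> s A)"
          using d sA tB by (simp only: d(2), subst f.G.rcos_eq_iff[OF K]) auto
        then show "C \<in> ?h ` ((rcosets\<^bsub>E\<^esub> P) \<times> (rcosets\<^bsub>F\<^esub> Q))"
          using A B by auto
      qed
    qed
  qed
  from bij_betw_same_card[OF this] show ?thesis
    by (simp add: P_def Q_def card_cartesian_product)
qed


section \<open>Subgroups of the integers\<close>

definition multiples :: "nat \<Rightarrow> int set" where
  "multiples k = {n. int k dvd n}"

lemma subgroup_multiples: "subgroup (multiples k) integer_group"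
  by (rule group.subgroupI[OF group_integer_group]) (auto simp: multiples_def)

lemma multiples_inj: "multiples k = multiples l \<Longrightarrow> k = l"
proof -
  assume "multiples k = multiples l"
  then have "int k dvd int l" "int l dvd int k"
    unfolding multiples_def by (metis dvd_refl mem_Collect_eq)+
  then show "k = l"
    by (simp add: dvd_antisym)
qed

text \<open>
  Division with remainder by the least positive element; the trivial subgroup is \<open>multiples 0\<close>.
\<close>
lemma subgroup_integer_group_obtain:
  assumes "subgroup S integer_group"
  obtains k where "S = multiples k"
proof -
  interpret S: subgroup S integer_group by (rule assms)
  interpret Z: group integer_group by simp
  have add: "a + b \<in> S" if "a \<in> S" "b \<in> S" for a b
    using S.m_closed[OF that] by simp
  have neg: "- a \<in> S" if "a \<in> S" for a
    using S.m_inv_closed[OF that] by simp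
  have mult: "j * a \<in> S" if "a \<in> S" for a j
    using Z.subgroup_int_pow_closed[OF assms that, of j] by simp
  have zero: "0 \<in> S"
    using S.one_closed by simp
  show thesis
  proof (cases "\<exists>k>0. int k \<in> S")
    case False
    have "S \<subseteq> {0}"
    proof
      fix n assume "n \<in> S"
      then have "int (nat \<bar>n\<bar>) \<in> S"
        using neg by (cases "n \<ge> 0") auto
      then show "n \<in> {0}"
        using False by (metis insertI1 nat_0_iff abs_le_zero_iff gr0I)
    qed
    then have "S = multiples 0"
      using zero by (auto simp: multiples_def)
    then show thesis by (rule that)
  next
    case True
    define k where "k = (LEAST k. k > 0 \<and> int k \<in> S)"
    have k: "k > 0" "int k \<in> S"
      using LeastI_ex[OF True] by (auto simp: k_def)
    have "int k dvd n" if "n \<in> S" for n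
    proof -
      have "n mod int k = n + (- (n div int k)) * int k"
        by (simp add: minus_div_mult_eq_mod [symmetric])
      then have "n mod int k \<in> S"
        using add[OF that mult[OF k(2)]] by metis
      moreover have "0 \<le> n mod int k" "n mod int k < int k"
        using k by auto
      ultimately have "\<not> nat (n mod int k) > 0"
        using not_less_Least[of "nat (n mod int k)" "\<lambda>k. k > 0 \<and> int k \<in> S"] by (auto simp: k_def [symmetric] nat_less_iff)
      then show ?thesis
        using \<open>0 \<le> n mod int k\<close> by (simp add: dvd_eq_mod_eq_0)
    qed
    moreover have "n \<in> S" if "int k dvd n" for n
      using that mult[OF k(2)] by (metis dvd_def mult.commute)
    ultimately have "S = multiples k"
      by (auto simp: multiples_def)
    then show thesis by (rule that)
  qed
qed

text \<open>
  The case \<open>k = 0\<close> is consistent with the others because \<^const>\<open>card\<close> sends the infinitely many cosets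
  of the trivial subgroup to 0. It lets the index formula rule out subgroups of finite index that
  project to, or meet, the integers trivially.
\<close>
lemma card_rcosets_multiples: "card (rcosets\<^bsub>integer_group\<^esub> (multiples k)) = k"
proof -
  interpret Z: group integer_group by simp
  note eq_iff = Z.rcos_eq_iff[OF subgroup_multiples[of k], simplified]
  let ?c = "\<lambda>n. multiples k #>\<^bsub>integer_group\<^esub> n"
  show ?thesis
  proof (cases "k = 0")
    case True
    have "inj ?c"
      unfolding inj_def eq_iff using True by (simp add: multiples_def)
    then have "infinite (range ?c)"
      using finite_imageD infinite_UNIV_int by blast
    moreover have "rcosets\<^bsub>integer_group\<^esub> (multiples k) = range ?c"
      by (auto simp: RCOSETS_def)
    ultimately show ?thesis
      using True by simp
  next
    case False
    have "bij_betw ?c {0..<int k} (rcosets\<^bsub>integer_group\<^esub> (multiples k))"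
    proof (rule bij_betw_imageI)
      show "inj_on ?c {0..<int k}"
        by (rule inj_onI)
          (metis eq_iff multiples_def mem_Collect_eq mod_eq_dvd_iff mod_pos_pos_trivial atLeastLessThan_iff diff_conv_add_uminus)
      have "?c n \<in> ?c ` {0..<int k}" for n
      proof (rule image_eqI)
        show "?c n = ?c (n mod int k)"
          unfolding eq_iff by (simp add: multiples_def minus_mod_eq_mult_div)
      qed (use False in simp)
      then show "?c ` {0..<int k} = rcosets\<^bsub>integer_group\<^esub> (multiples k)"
        by (auto simp: RCOSETS_def)
    qed
    then show ?thesis
      using bij_betw_same_card by fastforce
  qed
qed


section \<open>Normalizers\<close>

lemma (in group) mem_conj_iff:
  assumes "subgroup N G" "x \<in> carrier G"
  shows "y \<in> x <#\<^bsub>G\<^esub> N #> inv x \<longleftrightarrow> y \<in> carrier G \<and> inv x \<otimes> y \<otimes> x \<in> N"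
proof
  interpret N: subgroup N G by (rule assms)
  assume "y \<in> x <#\<^bsub>G\<^esub> N #> inv x"
  then obtain n where "n \<in> N" "y = x \<otimes> n \<otimes> inv x"
    by (auto simp: l_coset_def r_coset_def)
  then show "y \<in> carrier G \<and> inv x \<otimes> y \<otimes> x \<in> N"
    using assms by (auto simp: m_assoc mult_inv_cancel)
next
  assume y: "y \<in> carrier G \<and> inv x \<otimes> y \<otimes> x \<in> N"
  then have "y = x \<otimes> (inv x \<otimes> y \<otimes> x) \<otimes> inv x"
    using assms by (simp add: m_assoc mult_inv_cancel)
  then show "y \<in> x <#\<^bsub>G\<^esub> N #> inv x"
    using y by (auto simp: l_coset_def r_coset_def)
qed

lemma (in group) mem_normalizer_iff:
  assumes "subgroup N G"
  shows "x \<in> normalizer G N \<longleftrightarrow> x \<in> carrier G \<and> x <#\<^bsub>G\<^esub> N #> inv x = N"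
  using subgroup.subset[OF assms] unfolding normalizer_def stabilizer_def by simp

text \<open>
  Both inclusions are required: in an infinite group, conjugation can map a subgroup into a proper part
  of itself.
\<close>
lemma (in group) normalizerI:
  assumes "subgroup N G" "x \<in> carrier G"
    and "\<And>n. n \<in> N \<Longrightarrow> x \<otimes> n \<otimes> inv x \<in> N" "\<And>n. n \<in> N \<Longrightarrow> inv x \<otimes> n \<otimes> x \<in> N"
  shows "x \<in> normalizer G N"
proof -
  interpret N: subgroup N G by (rule assms)
  have "y \<in> N" if "y \<in> carrier G" "inv x \<otimes> y \<otimes> x \<in> N" for y
    using assms(3)[OF that(2)] that(1) assms(2) by (simp add: m_assoc mult_inv_cancel)
  then have "y \<in> x <#\<^bsub>G\<^esub> N #> inv x \<longleftrightarrow> y \<in> N" for y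
    using assms(4) mem_conj_iff[OF assms(1,2)] N.mem_carrier by blast
  then have "x <#\<^bsub>G\<^esub> N #> inv x = N"
    by blast
  then show ?thesis
    using assms(2) mem_normalizer_iff[OF assms(1)] by blast
qed

lemma (in group) normalizerD:
  assumes "subgroup N G" "x \<in> normalizer G N"
  shows "x \<in> carrier G" "n \<in> N \<Longrightarrow> inv x \<otimes> n \<otimes> x \<in> N" "n \<in> N \<Longrightarrow> x \<otimes> n \<otimes> inv x \<in> N"
proof -
  interpret N: subgroup N G by (rule assms)
  have D: "inv y \<otimes> n \<otimes> y \<in> N" if "y \<in> normalizer G N" "n \<in> N" for y n
    using that mem_normalizer_iff[OF assms(1)] mem_conj_iff[OF assms(1)] by blast
  show x: "x \<in> carrier G"
    using assms mem_normalizer_iff by blast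
  have "inv x \<in> normalizer G N"
    using subgroup.m_inv_closed[OF normalizer_imp_subgroup[OF N.subset] assms(2)] .
  then show "n \<in> N \<Longrightarrow> inv x \<otimes> n \<otimes> x \<in> N" "n \<in> N \<Longrightarrow> x \<otimes> n \<otimes> inv x \<in> N"
    using D[OF assms(2)] D[of "inv x"] x by auto
qed


section \<open>Subgroups of the product with the integers\<close>

definition fibre :: "('a \<times> int) set \<Rightarrow> int \<Rightarrow> 'a set" where
  "fibre K n = {g. (g, n) \<in> K}"

context group
begin

lemma group_times_integer: "group (G \<times>\<times> integer_group)"
  by (simp add: DirProd_group is_group)

lemma int_pow_times_integer:
  assumes "x \<in> carrier G"
  shows "(x, n) [^]\<^bsub>G \<times>\<times> integer_group\<^esub> (j :: int) = (x [^] j, j * n)"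
proof -
  interpret GZ: group "G \<times>\<times> integer_group" by (rule group_times_integer)
  have "fst \<in> hom (G \<times>\<times> integer_group) G" "snd \<in> hom (G \<times>\<times> integer_group) integer_group"
    by (auto simp: hom_def)
  then show ?thesis
    using hom_int_pow[of fst "G \<times>\<times> integer_group" G "(x, n)" j]
      hom_int_pow[of snd "G \<times>\<times> integer_group" integer_group "(x, n)" j] assms
    by (simp add: prod_eq_iff GZ.is_group is_group)
qed

context
  fixes K assumes K: "subgroup K (G \<times>\<times> integer_group)"
begin

lemma times_integer_subgroupD:
  shows "(g, n) \<in> K \<Longrightarrow> g \<in> carrier G"
    and "(\<one>, 0) \<in> K"
    and "(g, n) \<in> K \<Longrightarrow> (h, l) \<in> K \<Longrightarrow> (g \<otimes> h, n + l) \<in> K"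
    and "(g, n) \<in> K \<Longrightarrow> (inv g, - n) \<in> K"
    and "(g, n) \<in> K \<Longrightarrow> (g [^] (j :: int), j * n) \<in> K"
proof -
  interpret K: subgroup K "G \<times>\<times> integer_group" by (rule K)
  show carr: "(g, n) \<in> K \<Longrightarrow> g \<in> carrier G" for g n
    using K.subset by auto
  show "(\<one>, 0) \<in> K"
    using K.one_closed by simp
  show "(g, n) \<in> K \<Longrightarrow> (h, l) \<in> K \<Longrightarrow> (g \<otimes> h, n + l) \<in> K"
    using K.m_closed[of "(g, n)" "(h, l)"] by simp
  show "(g, n) \<in> K \<Longrightarrow> (inv g, - n) \<in> K"
    using K.m_inv_closed[of "(g, n)"] carr[of g n] by (simp add: is_group)
  show "(g, n) \<in> K \<Longrightarrow> (g [^] (j :: int), j * n) \<in> K"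
    using group.subgroup_int_pow_closed[OF group_times_integer K, of "(g, n)" j] carr[of g n]
    by (simp add: int_pow_times_integer)
qed

lemma subgroup_fibre_0: "subgroup (fibre K 0) G"
proof (rule subgroupI)
  show "fibre K 0 \<subseteq> carrier G" "fibre K 0 \<noteq> {}"
    using times_integer_subgroupD(1,2) by (auto simp: fibre_def)
  show "inv a \<in> fibre K 0" if "a \<in> fibre K 0" for a
    using that times_integer_subgroupD(4)[of a 0] by (simp add: fibre_def)
  show "a \<otimes> b \<in> fibre K 0" if "a \<in> fibre K 0" "b \<in> fibre K 0" for a b
    using that times_integer_subgroupD(3)[of a 0 b 0] by (simp add: fibre_def)
qed

text \<open>
  The sequence \<open>G \<rightarrow> G \<times> \<int> \<rightarrow> \<int>\<close>; the companion below uses \<open>\<int> \<rightarrow> G \<times> \<int> \<rightarrow> G\<close>.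
\<close>
lemma card_rcosets_via_snd:
  "card (rcosets\<^bsub>G \<times>\<times> integer_group\<^esub> K) =
     card (rcosets\<^bsub>integer_group\<^esub> (snd ` K)) * card (rcosets (fibre K 0))"
proof -
  have "group_hom (G \<times>\<times> integer_group) integer_group snd"
    "group_hom G (G \<times>\<times> integer_group) (\<lambda>g. (g, 0))"
    using group_times_integer is_group
    by (auto simp: group_hom_def group_hom_axioms_def hom_def)
  note * = card_rcosets_short_exact[OF this(1) _ this(2) _ K]
  have "fibre K 0 = {g \<in> carrier G. (g, 0) \<in> K}"
    using times_integer_subgroupD(1) by (auto simp: fibre_def)
  then show ?thesis
    by (subst *) (auto simp: kernel_def image_iff intro: bexI[of _ \<one>])
qed

lemma card_rcosets_via_fst:
  "card (rcosets\<^bsub>G \<times>\<times> integer_group\<^esub> K) =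
     card (rcosets (fst ` K)) * card (rcosets\<^bsub>integer_group\<^esub> {n. (\<one>, n) \<in> K})"
proof -
  have "group_hom (G \<times>\<times> integer_group) G fst"
    "group_hom integer_group (G \<times>\<times> integer_group) (\<lambda>n. (\<one>, n))"
    using group_times_integer is_group
    by (auto simp: group_hom_def group_hom_axioms_def hom_def)
  note * = card_rcosets_short_exact[OF this(1) _ this(2) _ K]
  show ?thesis
    by (subst *) (auto simp: kernel_def image_iff)
qed

lemma subgroup_snd_image: obtains k where "snd ` K = multiples k"
proof -
  have "group_hom (G \<times>\<times> integer_group) integer_group snd"
    using group_times_integer
    by (auto simp: group_hom_def group_hom_axioms_def hom_def)
  from group_hom.subgroup_img_is_subgroup[OF this K]
  show thesis
    by (rule subgroup_integer_group_obtain) (rule that)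
qed

lemma subgroup_fst_image: "subgroup (fst ` K) G"
proof -
  have "group_hom (G \<times>\<times> integer_group) G fst"
    using group_times_integer is_group
    by (auto simp: group_hom_def group_hom_axioms_def hom_def)
  from group_hom.subgroup_img_is_subgroup[OF this K]
  show ?thesis .
qed

lemma subgroup_inter_integers: obtains r where "{n. (\<one>, n) \<in> K} = multiples r"
proof -
  have "subgroup {n. (\<one>, n) \<in> K} integer_group"
  proof (rule group.subgroupI)
    show "{n. (\<one>, n) \<in> K} \<noteq> {}"
      using times_integer_subgroupD(2) by blast
    show "inv\<^bsub>integer_group\<^esub> a \<in> {n. (\<one>, n) \<in> K}" if "a \<in> {n. (\<one>, n) \<in> K}" for a
      using that times_integer_subgroupD(4)[of \<one> a] by simp
    show "a \<otimes>\<^bsub>integer_group\<^esub> b \<in> {n. (\<one>, n) \<in> K}"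
      if "a \<in> {n. (\<one>, n) \<in> K}" "b \<in> {n. (\<one>, n) \<in> K}" for a b
      using that times_integer_subgroupD(3)[of \<one> a \<one> b] by simp
  qed auto
  then show thesis
    by (rule subgroup_integer_group_obtain) (rule that)
qed

text \<open>
  Any \<open>x\<close> over \<open>k\<close> normalizes the fibre over 0, because conjugating \<open>(n, 0)\<close> by \<open>(x, k)\<close> leaves the
  integer component 0.
\<close>
lemma fibre_coset:
  assumes "snd ` K = multiples k"
  shows "fibre K (int k) \<in> rcosets\<^bsub>G\<lparr>carrier := normalizer G (fibre K 0)\<rparr>\<^esub> (fibre K 0)"
proof -
  have "int k \<in> snd ` K"
    using assms by (simp add: multiples_def)
  then obtain x where x: "(x, int k) \<in> K"
    by auto
  then have xG: "x \<in> carrier G"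
    by (rule times_integer_subgroupD(1))
  note xi = times_integer_subgroupD(4)[OF x]
  have "x \<in> normalizer G (fibre K 0)"
  proof (rule normalizerI[OF subgroup_fibre_0 xG])
    fix n assume "n \<in> fibre K 0"
    then have n: "(n, 0) \<in> K" by (simp add: fibre_def)
    show "x \<otimes> n \<otimes> inv x \<in> fibre K 0"
      using times_integer_subgroupD(3)[OF times_integer_subgroupD(3)[OF x n] xi] by (simp add: fibre_def)
    show "inv x \<otimes> n \<otimes> x \<in> fibre K 0"
      using times_integer_subgroupD(3)[OF times_integer_subgroupD(3)[OF xi n] x] by (simp add: fibre_def)
  qed
  moreover have "fibre K (int k) = fibre K 0 #> x"
  proof
    show "fibre K (int k) \<subseteq> fibre K 0 #> x"
    proof
      fix g assume "g \<in> fibre K (int k)"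
      then have g: "(g, int k) \<in> K" by (simp add: fibre_def)
      then have "(g \<otimes> inv x, 0) \<in> K"
        using times_integer_subgroupD(3)[OF g xi] by simp
      then show "g \<in> fibre K 0 #> x"
        using subgroup.rcos_module_rev[OF subgroup_fibre_0 is_group xG times_integer_subgroupD(1)[OF g]]
        by (simp add: fibre_def)
    qed
    show "fibre K 0 #> x \<subseteq> fibre K (int k)"
      using times_integer_subgroupD(3)[OF _ x, of _ 0] by (auto simp: fibre_def r_coset_def)
  qed
  ultimately show ?thesis
    by (auto simp: RCOSETS_def)
qed

end

text \<open>
  The two fibres generate \<open>K\<close>: multiplying \<open>(g, j k)\<close> by the \<open>-j\<close>-th power of an element over \<open>k\<close>
  lands in the fibre over 0.
\<close>
lemma subgroup_le_by_fibres:
  assumes K: "subgroup K (G \<times>\<times> integer_group)" and L: "subgroup L (G \<times>\<times> integer_group)"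
    and k: "snd ` K = multiples k"
    and eq: "fibre K 0 \<subseteq> fibre L 0" "fibre K (int k) \<subseteq> fibre L (int k)"
  shows "K \<subseteq> L"
proof clarify
  fix g n assume g: "(g, n) \<in> K"
  then have "n \<in> snd ` K"
    by (rule image_eqI[rotated]) simp
  then obtain j where n: "n = j * int k"
    using k by (auto simp: multiples_def dvd_def mult.commute)
  have "int k \<in> snd ` K"
    using k by (simp add: multiples_def)
  then obtain x where x: "(x, int k) \<in> K"
    by auto
  then have xL: "(x, int k) \<in> L"
    using eq(2) by (auto simp: fibre_def)
  note carr = times_integer_subgroupD(1)[OF K g] times_integer_subgroupD(1)[OF K x]
  have "(g \<otimes> x [^] (- j), n + (- j) * int k) \<in> K"
    by (intro times_integer_subgroupD(3,5)[OF K] g x)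
  then have "(g \<otimes> x [^] (- j), 0) \<in> L"
    using eq(1) by (auto simp: fibre_def n)
  then have "(g \<otimes> x [^] (- j) \<otimes> x [^] j, 0 + j * int k) \<in> L"
    by (intro times_integer_subgroupD(3,5)[OF L] xL)
  then show "(g, n) \<in> L"
    using carr by (simp add: n m_assoc flip: int_pow_mult)
qed

text \<open>
  For \<open>A = N x\<close>, take the products of \<open>(n, 0)\<close> with the powers of \<open>(x, k)\<close>. They are closed under
  multiplication because the powers of \<open>x\<close> normalize \<open>N\<close>, and \<open>k > 0\<close> ensures that the exponent of
  \<open>x\<close> can be read off from the integer component.
\<close>
lemma exists_subgroup_with_fibres:
  assumes N: "subgroup N G" and A: "A \<in> rcosets\<^bsub>G\<lparr>carrier := normalizer G N\<rparr>\<^esub> N" and k: "k > 0"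
  obtains K where "subgroup K (G \<times>\<times> integer_group)" "snd ` K = multiples k"
    "fibre K 0 = N" "fibre K (int k) = A"
proof -
  interpret N: subgroup N G by (rule N)
  obtain x where x: "x \<in> normalizer G N" "A = N #> x"
    using A by (auto simp: RCOSETS_def)
  have xG: "x \<in> carrier G"
    using normalizerD(1)[OF N x(1)] .
  have xj: "x [^] j \<in> normalizer G N" for j :: int
    by (rule subgroup_int_pow_closed[OF normalizer_imp_subgroup[OF N.subset] x(1)])
  define K where "K = {(n \<otimes> x [^] j, j * int k) | n j. n \<in> N}"
  have KI: "(g, l) \<in> K" if "n \<in> N" "g = n \<otimes> x [^] j" "l = j * int k" for g l n and j :: int
    using that unfolding K_def by blast
  have "subgroup K (G \<times>\<times> integer_group)"
  proof (rule group.subgroupI[OF group_times_integer])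
    show "K \<subseteq> carrier (G \<times>\<times> integer_group)"
      using xG by (auto simp: K_def)
    show "K \<noteq> {}"
      using KI[OF N.one_closed refl refl] by auto
  next
    fix a assume "a \<in> K"
    then obtain n j where a: "a = (n \<otimes> x [^] j, j * int k)" and n: "n \<in> N"
      by (auto simp: K_def)
    have n': "inv (x [^] j) \<otimes> inv n \<otimes> x [^] j \<in> N"
      using n by (intro normalizerD(2)[OF N xj]) auto
    have "inv\<^bsub>G \<times>\<times> integer_group\<^esub> a = (inv (n \<otimes> x [^] j), - (j * int k))"
      using n xG unfolding a by (simp add: is_group)
    moreover have "inv (n \<otimes> x [^] j) = (inv (x [^] j) \<otimes> inv n \<otimes> x [^] j) \<otimes> x [^] (- j)"
      using n xG by (simp add: inv_mult_group m_assoc int_pow_neg)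
    ultimately show "inv\<^bsub>G \<times>\<times> integer_group\<^esub> a \<in> K"
      using KI[OF n', of _ "- j"] by simp
  next
    fix a b assume "a \<in> K" "b \<in> K"
    then obtain n j n' j' where a: "a = (n \<otimes> x [^] j, j * int k)" and n: "n \<in> N"
      and b: "b = (n' \<otimes> x [^] j', j' * int k)" and n': "n' \<in> N"
      by (auto simp: K_def)
    have nn: "n \<otimes> (x [^] j \<otimes> n' \<otimes> inv (x [^] j)) \<in> N"
      using n n' by (intro N.m_closed normalizerD(3)[OF N xj])
    have "n \<otimes> x [^] j \<otimes> (n' \<otimes> x [^] j') = n \<otimes> (x [^] j \<otimes> n' \<otimes> inv (x [^] j)) \<otimes> x [^] (j + j')"
      using n n' xG by (simp add: m_assoc int_pow_mult mult_inv_cancel)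
    then show "a \<otimes>\<^bsub>G \<times>\<times> integer_group\<^esub> b \<in> K"
      unfolding a b using KI[OF nn, of _ "j + j'"] by (simp add: algebra_simps)
  qed
  moreover have "snd ` K = multiples k"
  proof
    show "snd ` K \<subseteq> multiples k"
      by (auto simp: K_def multiples_def)
    have "j * int k \<in> snd ` K" for j
      using imageI[OF KI[OF N.one_closed refl refl, of j], of snd] by simp
    then show "multiples k \<subseteq> snd ` K"
      by (auto simp: multiples_def dvd_def mult.commute)
  qed
  moreover have "fibre K 0 = N"
  proof -
    have "g \<in> N" if "(g, 0) \<in> K" for g
      using that k by (auto simp: K_def)
    moreover have "(g, 0) \<in> K" if "g \<in> N" for g
      using that by (intro KI[OF that, of _ 0]) auto
    ultimately show ?thesis
      by (auto simp: fibre_def)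
  qed
  moreover have "fibre K (int k) = A"
  proof -
    have "g \<in> A" if "(g, int k) \<in> K" for g
      using that k xG by (auto simp: K_def x(2) r_coset_def)
    moreover have "(g, int k) \<in> K" if "g \<in> A" for g
      using that xG KI[of _ _ 1] by (auto simp: x(2) r_coset_def)
    ultimately show ?thesis
      by (auto simp: fibre_def)
  qed
  ultimately show thesis
    by (rule that)
qed

text \<open>
  Here \<open>r\<close> is the index of the fibre over 0, and the image of \<open>K\<close> in the integers consists of the
  multiples of \<open>m div r\<close>.
\<close>
lemma bij_betw_subgroups_fibres:
  assumes m: "m \<ge> 1"
  shows "bij_betw
    (\<lambda>K. let r = card (rcosets (fibre K 0)) in (r, fibre K 0, fibre K (int (m div r))))
    (subgroups_of_index (G \<times>\<times> integer_group) m)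
    (SIGMA r:{r. r dvd m}. SIGMA N:subgroups_of_index G r.
       rcosets\<^bsub>G\<lparr>carrier := normalizer G N\<rparr>\<^esub> N)"
    (is "bij_betw ?\<Phi> ?X ?Y")
proof -
  have data: "subgroup K (G \<times>\<times> integer_group) \<and> card (rcosets (fibre K 0)) dvd m \<and>
      snd ` K = multiples (m div card (rcosets (fibre K 0)))" if "K \<in> ?X" for K
  proof -
    have K: "subgroup K (G \<times>\<times> integer_group)" and "card (rcosets\<^bsub>G \<times>\<times> integer_group\<^esub> K) = m"
      using that by (auto simp: subgroups_of_index_def)
    moreover obtain k where "snd ` K = multiples k"
      using subgroup_snd_image[OF K] .
    ultimately have "m = k * card (rcosets (fibre K 0))" "snd ` K = multiples k"
      using card_rcosets_via_snd[OF K] by (simp_all add: card_rcosets_multiples)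
    then show ?thesis
      using m K by auto
  qed
  show ?thesis
  proof (rule bij_betw_imageI)
    show "inj_on ?\<Phi> ?X"
    proof (rule inj_onI)
      fix K L assume KL: "K \<in> ?X" "L \<in> ?X" and eq: "?\<Phi> K = ?\<Phi> L"
      define k where "k = m div card (rcosets (fibre K 0))"
      have "fibre K 0 = fibre L 0" "fibre K (int k) = fibre L (int k)"
        using eq by (auto simp: Let_def k_def)
      moreover have "snd ` K = multiples k" "snd ` L = multiples k"
        using data[OF KL(1)] data[OF KL(2)] calculation(1) by (auto simp: k_def)
      ultimately show "K = L"
        using data[OF KL(1)] data[OF KL(2)]
          subgroup_le_by_fibres[of K L k] subgroup_le_by_fibres[of L K k] by auto
    qed
    show "?\<Phi> ` ?X = ?Y"
    proof
      have "?\<Phi> K \<in> ?Y" if "K \<in> ?X" for K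
        using data[OF that] fibre_coset[of K] subgroup_fibre_0[of K]
        by (simp add: Let_def subgroups_of_index_def)
      then show "?\<Phi> ` ?X \<subseteq> ?Y" by blast
      show "?Y \<subseteq> ?\<Phi> ` ?X"
      proof clarify
        fix r N A
        assume r: "r dvd m" and N: "N \<in> subgroups_of_index G r"
          and A: "A \<in> rcosets\<^bsub>G\<lparr>carrier := normalizer G N\<rparr>\<^esub> N"
        have N': "subgroup N G" "card (rcosets N) = r"
          using N by (auto simp: subgroups_of_index_def)
        have "m div r > 0"
          using r m by (metis dvd_div_eq_0_iff gr0I not_one_le_zero)
        then obtain K where K: "subgroup K (G \<times>\<times> integer_group)" "snd ` K = multiples (m div r)"
          "fibre K 0 = N" "fibre K (int (m div r)) = A"
          using exists_subgroup_with_fibres[OF N'(1) A] by metis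
        have "card (rcosets\<^bsub>G \<times>\<times> integer_group\<^esub> K) = m"
          using card_rcosets_via_snd[OF K(1)] K(2,3) N'(2) r by (simp add: card_rcosets_multiples)
        then have "K \<in> ?X"
          using K(1) by (simp add: subgroups_of_index_def)
        moreover have "(r, N, A) = ?\<Phi> K"
          using K(3,4) N'(2) by (simp add: Let_def)
        ultimately show "(r, N, A) \<in> ?\<Phi> ` ?X" by blast
      qed
    qed
  qed
qed


section \<open>Conjugacy classes of subgroups\<close>

abbreviation conj_class :: "'a set \<Rightarrow> 'a set set" where
  "conj_class \<equiv> orbit G (\<lambda>g H. g <#\<^bsub>G\<^esub> H #> inv g)"

lemma conj_conj:
  assumes "N \<subseteq> carrier G" "g \<in> carrier G" "h \<in> carrier G"
  shows "g <#\<^bsub>G\<^esub> (h <#\<^bsub>G\<^esub> N #> inv h) #> inv g = (g \<otimes> h) <#\<^bsub>G\<^esub> N #> inv (g \<otimes> h)"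
  using group_action.composition_rule[OF action_by_conjugation_on_power_set, of N g h] assms
  by (simp add: l_coset_subset_G r_coset_subset_G)

lemma conj_one: "N \<subseteq> carrier G \<Longrightarrow> \<one> <#\<^bsub>G\<^esub> N #> inv \<one> = N"
  by (simp add: lcos_mult_one)

lemma conj_self:
  assumes "subgroup N G" "n \<in> N"
  shows "n <#\<^bsub>G\<^esub> N #> inv n = N"
  using assms by (simp add: coset_join2 coset_join3 subgroup.mem_carrier subgroup.m_inv_closed)

lemma conj_inv_eq:
  assumes "N \<subseteq> carrier G" "g \<in> carrier G" "g <#\<^bsub>G\<^esub> N #> inv g = M"
  shows "inv g <#\<^bsub>G\<^esub> M #> inv (inv g) = N"
  using conj_conj[of N "inv g" g] assms conj_one by auto

lemma l_coset_of_r_coset: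
  assumes "N \<subseteq> carrier G" "g \<in> carrier G" "a \<in> carrier G"
  shows "g <#\<^bsub>G\<^esub> (N #> a) = (g <#\<^bsub>G\<^esub> N #> inv g) #> (g \<otimes> a)"
  using assms by (simp add: coset_assoc coset_mult_assoc l_coset_subset_G mult_inv_cancel)

lemma l_coset_cancel:
  assumes "A \<subseteq> carrier G" "B \<subseteq> carrier G" "g \<in> carrier G" "g <#\<^bsub>G\<^esub> A = g <#\<^bsub>G\<^esub> B"
  shows "A = B"
proof -
  have "inv g <#\<^bsub>G\<^esub> (g <#\<^bsub>G\<^esub> C) = C" if "C \<subseteq> carrier G" for C
    using that assms(3) by (simp add: lcos_m_assoc lcos_mult_one)
  then show ?thesis
    using assms(1,2,4) by metis
qed

lemma card_rcosets_conj:
  assumes N: "subgroup N G" and g: "g \<in> carrier G"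
  shows "card (rcosets (g <#\<^bsub>G\<^esub> N #> inv g)) = card (rcosets N)"
proof -
  have NG: "N \<subseteq> carrier G"
    using N by (rule subgroup.subset)
  have "bij_betw (\<lambda>A. g <#\<^bsub>G\<^esub> A) (rcosets N) (rcosets (g <#\<^bsub>G\<^esub> N #> inv g))"
  proof (rule bij_betw_imageI)
    show "inj_on (\<lambda>A. g <#\<^bsub>G\<^esub> A) (rcosets N)"
      using l_coset_cancel g subgroup.rcosets_carrier[OF N is_group] by (metis inj_onI)
    have "(g <#\<^bsub>G\<^esub> N #> inv g) #> a \<in> (\<lambda>A. g <#\<^bsub>G\<^esub> A) ` (rcosets N)" if "a \<in> carrier G" for a
      using l_coset_of_r_coset[OF NG g, of "inv g \<otimes> a"] that g NG
      by (intro image_eqI[of _ _ "N #> (inv g \<otimes> a)"]) (auto simp: mult_inv_cancel intro!: rcosetsI)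
    then show "(\<lambda>A. g <#\<^bsub>G\<^esub> A) ` (rcosets N) = rcosets (g <#\<^bsub>G\<^esub> N #> inv g)"
      using g NG by (auto simp: RCOSETS_def l_coset_of_r_coset)
  qed
  then show ?thesis
    by (metis bij_betw_same_card)
qed

lemma conj_classI: "g \<in> carrier G \<Longrightarrow> g <#\<^bsub>G\<^esub> N #> inv g = M \<Longrightarrow> M \<in> conj_class N"
  unfolding orbit_def by (intro CollectI exI[of _ g] conjI) (rule sym)

lemma conj_classE:
  assumes "M \<in> conj_class N"
  obtains g where "g \<in> carrier G" "g <#\<^bsub>G\<^esub> N #> inv g = M"
proof -
  have "\<exists>g. M = g <#\<^bsub>G\<^esub> N #> inv g \<and> g \<in> carrier G"
    using assms unfolding orbit_def by (rule CollectD)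
  then show thesis
    using that by metis
qed

lemma conj_class_refl: "N \<subseteq> carrier G \<Longrightarrow> N \<in> conj_class N"
  by (rule conj_classI[OF one_closed]) (rule conj_one)

lemma conj_class_subset:
  assumes "N \<in> subgroups_of_index G r"
  shows "conj_class N \<subseteq> subgroups_of_index G r"
proof
  fix M assume "M \<in> conj_class N"
  then obtain g where "g \<in> carrier G" "g <#\<^bsub>G\<^esub> N #> inv g = M"
    by (rule conj_classE)
  then show "M \<in> subgroups_of_index G r"
    using assms subgroup_conjugation_is_surj2[of g N] card_rcosets_conj[of N g]
    by (simp add: subgroups_of_index_def)
qed

lemma conj_class_eq:
  assumes N: "N \<subseteq> carrier G" and M: "M \<in> conj_class N"
  shows "conj_class M = conj_class N"
proof -
  have sub: "conj_class M \<subseteq> conj_class N" if N: "N \<subseteq> carrier G" and M: "M \<in> conj_class N" for M N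
  proof
    fix L assume "L \<in> conj_class M"
    then obtain g where g: "g \<in> carrier G" "g <#\<^bsub>G\<^esub> M #> inv g = L"
      by (rule conj_classE)
    obtain h where h: "h \<in> carrier G" "h <#\<^bsub>G\<^esub> N #> inv h = M"
      using M by (rule conj_classE)
    show "L \<in> conj_class N"
      using conj_conj[OF N g(1) h(1)] g h by (intro conj_classI[of "g \<otimes> h"]) simp_all
  qed
  obtain g where g: "g \<in> carrier G" "g <#\<^bsub>G\<^esub> N #> inv g = M"
    using M by (rule conj_classE)
  have "N \<in> conj_class M"
    by (rule conj_classI[OF inv_closed conj_inv_eq]) (use g N in auto)
  moreover have "M \<subseteq> carrier G"
    using g N l_coset_subset_G[of N g] r_coset_subset_G[of _ "inv g"] by blast
  ultimately show ?thesis
    using sub N M by blast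
qed

text \<open>
  Orbit and stabilizer in one bijection, valid for any index. Choose for each \<open>N\<close> in the class an element
  \<open>t\<close> with \<open>t N t\<inverse> = N\<^sub>0\<close>. If \<open>x\<close> normalizes \<open>N\<close>, then \<open>t N x = N\<^sub>0 t x\<close> is a coset of
  \<open>N\<^sub>0\<close>. Conversely, a coset \<open>N\<^sub>0 g\<close> determines \<open>N = g\<inverse> N\<^sub>0 g\<close>, and \<open>t\<inverse> g\<close> normalizes \<open>N\<close>.
\<close>
lemma conj_class_normalizer_cosets:
  assumes N0: "subgroup N\<^sub>0 G"
  shows "|SIGMA N:conj_class N\<^sub>0. rcosets\<^bsub>G\<lparr>carrier := normalizer G N\<rparr>\<^esub> N| =o |rcosets N\<^sub>0|"
proof -
  let ?W = "\<lambda>N. rcosets\<^bsub>G\<lparr>carrier := normalizer G N\<rparr>\<^esub> N"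
  have N0G: "N\<^sub>0 \<subseteq> carrier G"
    using N0 by (rule subgroup.subset)
  have sub: "subgroup N G" if "N \<in> conj_class N\<^sub>0" for N
    using conj_classE[OF that] subgroup_conjugation_is_surj2[OF _ N0] by metis
  have "\<exists>t \<in> carrier G. t <#\<^bsub>G\<^esub> N #> inv t = N\<^sub>0" if "N \<in> conj_class N\<^sub>0" for N
  proof -
    obtain g where g: "g \<in> carrier G" "g <#\<^bsub>G\<^esub> N\<^sub>0 #> inv g = N"
      using \<open>N \<in> conj_class N\<^sub>0\<close> by (rule conj_classE)
    from conj_inv_eq[OF N0G this] show ?thesis
      using g(1) by blast
  qed
  then have "\<forall>N \<in> conj_class N\<^sub>0. \<exists>t. t \<in> carrier G \<and> t <#\<^bsub>G\<^esub> N #> inv t = N\<^sub>0"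
    by blast
  from bchoice[OF this] obtain t
    where "\<forall>N \<in> conj_class N\<^sub>0. t N \<in> carrier G \<and> t N <#\<^bsub>G\<^esub> N #> inv (t N) = N\<^sub>0" ..
  then have t: "t N \<in> carrier G \<and> t N <#\<^bsub>G\<^esub> N #> inv (t N) = N\<^sub>0" if "N \<in> conj_class N\<^sub>0" for N
    using that by blast
  have image: "\<exists>x \<in> carrier G. A = N #> x \<and> x <#\<^bsub>G\<^esub> N #> inv x = N \<and> t N <#\<^bsub>G\<^esub> A = N\<^sub>0 #> (t N \<otimes> x)"
    if N: "N \<in> conj_class N\<^sub>0" and A: "A \<in> ?W N" for N A
  proof -
    obtain x where x: "x \<in> normalizer G N" "A = N #> x"
      using A by (auto simp: RCOSETS_def)
    have xG: "x \<in> carrier G" "x <#\<^bsub>G\<^esub> N #> inv x = N"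
      using x(1) mem_normalizer_iff[OF sub[OF N]] by blast+
    moreover have "t N <#\<^bsub>G\<^esub> A = N\<^sub>0 #> (t N \<otimes> x)"
      using t[OF N] l_coset_of_r_coset[OF subgroup.subset[OF sub[OF N]] _ xG(1), of "t N"] x(2) by simp
    ultimately show ?thesis
      using x(2) by blast
  qed
  \<comment> \<open>The class member is recovered from the coset of \<open>N\<^sub>0\<close> as the conjugate by any representative.\<close>
  have recover: "inv (t N \<otimes> x) <#\<^bsub>G\<^esub> N\<^sub>0 #> inv (inv (t N \<otimes> x)) = N"
    if "N \<in> conj_class N\<^sub>0" "x \<in> carrier G" "x <#\<^bsub>G\<^esub> N #> inv x = N" for N x
  proof (rule conj_inv_eq)
    show NG: "N \<subseteq> carrier G"
      using sub[OF that(1)] by (rule subgroup.subset)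
    show "t N \<otimes> x <#\<^bsub>G\<^esub> N #> inv (t N \<otimes> x) = N\<^sub>0"
      using t[OF that(1)] that conj_conj[OF NG, of "t N" x] by simp
  qed (use t that in auto)
  have "bij_betw (\<lambda>(N, A). t N <#\<^bsub>G\<^esub> A) (SIGMA N:conj_class N\<^sub>0. ?W N) (rcosets N\<^sub>0)"
  proof (rule bij_betw_imageI)
    show "inj_on (\<lambda>(N, A). t N <#\<^bsub>G\<^esub> A) (SIGMA N:conj_class N\<^sub>0. ?W N)"
    proof (rule inj_onI, clarify)
      fix N A N' A'
      assume N: "N \<in> conj_class N\<^sub>0" "A \<in> ?W N" and N': "N' \<in> conj_class N\<^sub>0" "A' \<in> ?W N'"
        and eq: "t N <#\<^bsub>G\<^esub> A = t N' <#\<^bsub>G\<^esub> A'"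
      obtain x where x: "x \<in> carrier G" "A = N #> x" "x <#\<^bsub>G\<^esub> N #> inv x = N"
        "t N <#\<^bsub>G\<^esub> A = N\<^sub>0 #> (t N \<otimes> x)"
        using image[OF N] by blast
      obtain x' where x': "x' \<in> carrier G" "A' = N' #> x'" "x' <#\<^bsub>G\<^esub> N' #> inv x' = N'"
        "t N' <#\<^bsub>G\<^esub> A' = N\<^sub>0 #> (t N' \<otimes> x')"
        using image[OF N'] by blast
      let ?y = "t N \<otimes> x" and ?y' = "t N' \<otimes> x'"
      have y: "?y \<in> carrier G" "?y' \<in> carrier G"
        using t N N' x x' by auto
      have "?y \<otimes> inv ?y' \<in> N\<^sub>0"
        using rcos_eq_iff[OF N0 y] eq x(4) x'(4) by simp
      then obtain n where n: "n \<in> N\<^sub>0" "n = ?y \<otimes> inv ?y'"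
        by simp
      have nG: "n \<in> carrier G"
        using n N0G by blast
      have "inv ?y = inv ?y' \<otimes> inv n"
        using y unfolding n(2) by (simp add: inv_mult_group mult_inv_cancel del: m_closed)
      then have "inv ?y <#\<^bsub>G\<^esub> N\<^sub>0 #> inv (inv ?y) = inv ?y' <#\<^bsub>G\<^esub> (inv n <#\<^bsub>G\<^esub> N\<^sub>0 #> inv (inv n)) #> inv (inv ?y')"
        using conj_conj[OF N0G, of "inv ?y'" "inv n"] y nG by simp
      also have "\<dots> = inv ?y' <#\<^bsub>G\<^esub> N\<^sub>0 #> inv (inv ?y')"
        using conj_self[OF N0, of "inv n"] n(1) subgroup.m_inv_closed[OF N0] by simp
      finally have NN: "N = N'"
        using recover[OF N(1) x(1,3)] recover[OF N'(1) x'(1,3)] by simp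
      have "A \<subseteq> carrier G" "A' \<subseteq> carrier G"
        using r_coset_subset_G[OF subgroup.subset[OF sub[OF N(1)]] x(1)]
          r_coset_subset_G[OF subgroup.subset[OF sub[OF N'(1)]] x'(1)] x(2) x'(2) by simp_all
      then have "A = A'"
        using l_coset_cancel eq t[OF N(1)] unfolding NN by metis
      then show "N = N' \<and> A = A'"
        using NN by simp
    qed
    show "(\<lambda>(N, A). t N <#\<^bsub>G\<^esub> A) ` (SIGMA N:conj_class N\<^sub>0. ?W N) = rcosets N\<^sub>0"
    proof
      show "(\<lambda>(N, A). t N <#\<^bsub>G\<^esub> A) ` (SIGMA N:conj_class N\<^sub>0. ?W N) \<subseteq> rcosets N\<^sub>0"
      proof clarify
        fix N A assume N: "N \<in> conj_class N\<^sub>0" "A \<in> ?W N"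
        then obtain x where "x \<in> carrier G" "t N <#\<^bsub>G\<^esub> A = N\<^sub>0 #> (t N \<otimes> x)"
          using image by blast
        then show "t N <#\<^bsub>G\<^esub> A \<in> rcosets N\<^sub>0"
          using t[OF N(1)] N0G by (auto intro!: rcosetsI)
      qed
      show "rcosets N\<^sub>0 \<subseteq> (\<lambda>(N, A). t N <#\<^bsub>G\<^esub> A) ` (SIGMA N:conj_class N\<^sub>0. ?W N)"
      proof
        fix B assume "B \<in> rcosets N\<^sub>0"
        then obtain g where g: "g \<in> carrier G" "B = N\<^sub>0 #> g"
          by (auto simp: RCOSETS_def)
        define N where "N = inv g <#\<^bsub>G\<^esub> N\<^sub>0 #> inv (inv g)"
        have N: "N \<in> conj_class N\<^sub>0"
          using g(1) unfolding N_def by (intro conj_classI[OF _ refl]) simp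
        have NG: "N \<subseteq> carrier G"
          using sub[OF N] by (rule subgroup.subset)
        note tN = t[OF N]
        define x where "x = inv (t N) \<otimes> g"
        have x: "x \<in> carrier G"
          using tN g by (simp add: x_def)
        have "g <#\<^bsub>G\<^esub> N #> inv g = N\<^sub>0"
          using conj_inv_eq[OF N0G _ N_def[symmetric]] g by simp
        then have "x <#\<^bsub>G\<^esub> N #> inv x = inv (t N) <#\<^bsub>G\<^esub> N\<^sub>0 #> inv (inv (t N))"
          using conj_conj[OF NG, of "inv (t N)" g] tN g by (simp add: x_def)
        also have "\<dots> = N"
          using conj_inv_eq[OF NG] tN by blast
        finally have "x \<in> normalizer G N"
          using x mem_normalizer_iff[OF sub[OF N]] by blast
        then have "N #> x \<in> ?W N"
          by (auto simp: RCOSETS_def)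
        moreover have "B = t N <#\<^bsub>G\<^esub> (N #> x)"
          using l_coset_of_r_coset[OF NG _ x, of "t N"] tN g by (simp add: x_def mult_inv_cancel)
        ultimately show "B \<in> (\<lambda>(N, A). t N <#\<^bsub>G\<^esub> A) ` (SIGMA N:conj_class N\<^sub>0. ?W N)"
          using N by (intro image_eqI[of _ _ "(N, N #> x)"]) auto
      qed
    qed
  qed
  then show ?thesis
    using card_of_ordIso by blast
qed

text \<open>
  The assumption \<open>r \<ge> 1\<close> makes the index genuinely finite, so the \<open>r\<close> cosets of a class
  representative can be numbered by \<open>{..<r}\<close>.
\<close>
lemma normalizer_cosets_by_conj_classes:
  assumes r: "r \<ge> 1"
  shows "|SIGMA N:subgroups_of_index G r. rcosets\<^bsub>G\<lparr>carrier := normalizer G N\<rparr>\<^esub> N|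
    =o |{..<r} \<times> subgroup_conj_classes G r|"
proof -
  let ?W = "\<lambda>N. rcosets\<^bsub>G\<lparr>carrier := normalizer G N\<rparr>\<^esub> N"
  have cls: "subgroup_conj_classes G r = conj_class ` subgroups_of_index G r"
    by (auto simp: subgroup_conj_classes_def orbits_def)
  have NG: "N \<subseteq> carrier G" if "N \<in> subgroups_of_index G r" for N
    using that by (auto simp: subgroups_of_index_def dest: subgroup.subset)
  have "bij_betw (\<lambda>(N, A). (conj_class N, N, A)) (SIGMA N:subgroups_of_index G r. ?W N)
      (SIGMA C:subgroup_conj_classes G r. SIGMA N:C. ?W N)"
  proof (rule bij_betw_Sigma_blocks)
    show "conj_class N \<in> subgroup_conj_classes G r \<and> N \<in> conj_class N"
      if "N \<in> subgroups_of_index G r" for N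
      using that conj_class_refl[OF NG] unfolding cls by blast
    show "C = conj_class N \<and> N \<in> subgroups_of_index G r"
      if "C \<in> subgroup_conj_classes G r" "N \<in> C" for C N
      using that conj_class_eq[OF NG] conj_class_subset unfolding cls by blast
  qed
  then have "|SIGMA N:subgroups_of_index G r. ?W N|
      =o |SIGMA C:subgroup_conj_classes G r. SIGMA N:C. ?W N|"
    using card_of_ordIso by blast
  also have "|SIGMA C:subgroup_conj_classes G r. SIGMA N:C. ?W N|
      =o |SIGMA C:subgroup_conj_classes G r. {..<r}|"
  proof (rule card_of_Sigma_cong1)
    fix C assume "C \<in> subgroup_conj_classes G r"
    then obtain N where N: "C = conj_class N" "subgroup N G" "card (rcosets N) = r"
      by (auto simp: cls subgroups_of_index_def)
    have "finite (rcosets N)"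
      using N(3) r card.infinite by fastforce
    then have "|rcosets N| =o |{..<r}|"
      using N(3) finite_same_card_bij[of "rcosets N" "{..<r}"] card_of_ordIso by force
    with conj_class_normalizer_cosets[OF N(2)] show "|SIGMA N:C. ?W N| =o |{..<r}|"
      unfolding N(1) by (rule ordIso_transitive)
  qed
  also have "|SIGMA C:subgroup_conj_classes G r. {..<r}| =o |{..<r} \<times> subgroup_conj_classes G r|"
    by (rule card_of_Times_commute)
  finally show ?thesis .
qed


end


section \<open>Homomorphisms to finite cyclic groups\<close>

lemma (in comm_group) commutator_eq_one:
  assumes "x \<in> carrier G" "y \<in> carrier G"
  shows "x \<otimes> y \<otimes> inv x \<otimes> inv y = \<one>"
  using assms by (simp add: m_comm[of x y] m_assoc mult_inv_cancel)

context group
begin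

text \<open>
  Commutators lie in the kernel of a homomorphism to an abelian group, so it factors through the
  abelianization; restricting to the carriers makes the factorization unique.
\<close>
lemma bij_betw_Hom_abelianization:
  assumes A: "comm_group A"
  shows "bij_betw (\<lambda>\<psi>. \<lambda>x\<in>carrier G. \<psi> (derived G (carrier G) #> x))
    (Hom (abelianization G) A) (Hom G A)" (is "bij_betw ?\<Phi> _ _")
proof -
  interpret A: comm_group A by (rule A)
  let ?D = "derived G (carrier G)"
  interpret D: normal ?D G
    by (rule derived_self_is_normal)
  have carr: "carrier (abelianization G) = (\<lambda>x. ?D #> x) ` carrier G"
    by (auto simp: abelianization_def FactGroup_def RCOSETS_def)
  have mult: "(?D #> x) \<otimes>\<^bsub>abelianization G\<^esub> (?D #> y) = ?D #> (x \<otimes> y)"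
    if "x \<in> carrier G" "y \<in> carrier G" for x y
    using that by (simp add: abelianization_def FactGroup_def D.rcos_sum)
  show ?thesis
  proof (rule bij_betw_imageI)
    show "inj_on ?\<Phi> (Hom (abelianization G) A)"
    proof (rule inj_onI)
      fix \<psi> \<psi>' assume \<psi>: "\<psi> \<in> Hom (abelianization G) A" "\<psi>' \<in> Hom (abelianization G) A"
        and eq: "?\<Phi> \<psi> = ?\<Phi> \<psi>'"
      have "\<psi> (?D #> x) = \<psi>' (?D #> x)" if "x \<in> carrier G" for x
        using fun_cong[OF eq, of x] that by simp
      then show "\<psi> = \<psi>'"
        using \<psi> by (intro extensionalityI[of _ "carrier (abelianization G)"]) (auto simp: Hom_def carr)
    qed
    show "?\<Phi> ` Hom (abelianization G) A = Hom G A"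
    proof
      show "?\<Phi> ` Hom (abelianization G) A \<subseteq> Hom G A"
        by (auto simp: Hom_def hom_def carr mult[symmetric] Pi_iff)
      show "Hom G A \<subseteq> ?\<Phi> ` Hom (abelianization G) A"
      proof
        fix \<phi> assume \<phi>: "\<phi> \<in> Hom G A"
        interpret \<phi>: group_hom G A \<phi>
          using \<phi> by unfold_locales (auto simp: Hom_def)
        have "\<phi> (x \<otimes> y \<otimes> inv x \<otimes> inv y) = \<one>\<^bsub>A\<^esub>" if "x \<in> carrier G" "y \<in> carrier G" for x y
          using that by (simp add: A.commutator_eq_one)
        then have "derived_set G (carrier G) \<subseteq> kernel G A \<phi>"
          by (auto simp: kernel_def simp del: \<phi>.hom_mult)
        then have "?D \<subseteq> kernel G A \<phi>"
          unfolding derived_def by (rule generate_subgroup_incl[OF _ \<phi>.subgroup_kernel])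
        then obtain \<psi> where \<psi>: "\<psi> \<in> hom (abelianization G) A" "\<And>x. x \<in> carrier G \<Longrightarrow> \<psi> (?D #> x) = \<phi> x"
          using \<phi>.FactGroup_universal_kernel[OF derived_self_is_normal] unfolding abelianization_def by blast
        let ?\<psi> = "restrict \<psi> (carrier (abelianization G))"
        have "?\<psi> \<in> Hom (abelianization G) A"
          using \<psi>(1) mult by (auto simp: Hom_def hom_def carr)
        moreover have "\<phi> = ?\<Phi> ?\<psi>"
          using \<phi> \<psi>(2) by (intro extensionalityI[of _ "carrier G"]) (auto simp: Hom_def carr)
        ultimately show "\<phi> \<in> ?\<Phi> ` Hom (abelianization G) A" by blast
      qed
    qed
  qed
qed

text \<open>
  The pullback of the graph of \<open>\<phi>\<close>, a map from \<open>H\<close> to residues in \<open>{0..<r}\<close>, along reduction modulo \<open>r\<close>.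
\<close>
definition congruence_graph :: "nat \<Rightarrow> 'a set \<Rightarrow> ('a \<Rightarrow> int) \<Rightarrow> ('a \<times> int) set" where
  "congruence_graph r H \<phi> = {(h, n). h \<in> H \<and> n mod int r = \<phi> h}"

lemma Hom_mod_groupD:
  assumes "\<phi> \<in> Hom (G\<lparr>carrier := H\<rparr>) (integer_mod_group r)" "r > 0"
  shows "h \<in> H \<Longrightarrow> 0 \<le> \<phi> h \<and> \<phi> h < int r"
    and "h \<in> H \<Longrightarrow> h' \<in> H \<Longrightarrow> \<phi> (h \<otimes> h') = (\<phi> h + \<phi> h') mod int r"
  using assms by (auto simp: Hom_def hom_def carrier_integer_mod_group Pi_iff)

lemma congruence_graph_subgroup_data:
  assumes H: "subgroup H G" and r: "r > 0"
    and \<phi>: "\<phi> \<in> Hom (G\<lparr>carrier := H\<rparr>) (integer_mod_group r)"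
  shows "subgroup (congruence_graph r H \<phi>) (G \<times>\<times> integer_group)"
    and "fst ` congruence_graph r H \<phi> = H"
    and "{n. (\<one>, n) \<in> congruence_graph r H \<phi>} = multiples r"
proof -
  interpret H: subgroup H G by (rule H)
  note range = Hom_mod_groupD(1)[OF \<phi> r] and mult = Hom_mod_groupD(2)[OF \<phi> r]
  have mod: "\<phi> h mod int r = \<phi> h" if "h \<in> H" for h
    using range[OF that] by simp
  have one: "\<phi> \<one> = 0"
  proof -
    have "(\<phi> \<one> + \<phi> \<one>) mod int r = (0 + \<phi> \<one>) mod int r"
      using mult[of \<one> \<one>] mod[of \<one>] by simp
    then have "\<phi> \<one> mod int r = 0"
      by (simp add: mod_eq_dvd_iff dvd_eq_mod_eq_0)
    then show ?thesis
      using mod[of \<one>] by simp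
  qed
  have neg: "(- n) mod int r = \<phi> (inv h)" if "h \<in> H" "n mod int r = \<phi> h" for h n
  proof -
    have "(\<phi> h + \<phi> (inv h)) mod int r = 0"
      using mult[of h "inv h"] that one by simp
    then have "(n + \<phi> (inv h)) mod int r = 0"
      using that(2) by (metis mod_add_left_eq)
    then have "(- n) mod int r = \<phi> (inv h) mod int r"
      by (metis add.commute diff_minus_eq_add dvd_eq_mod_eq_0 mod_eq_dvd_iff)
    then show ?thesis
      using mod[of "inv h"] that by simp
  qed
  show "fst ` congruence_graph r H \<phi> = H"
  proof
    show "H \<subseteq> fst ` congruence_graph r H \<phi>"
      using mod by (intro subsetI image_eqI[of _ fst "(h, \<phi> h)" for h]) (auto simp: congruence_graph_def)
  qed (auto simp: congruence_graph_def)
  show "{n. (\<one>, n) \<in> congruence_graph r H \<phi>} = multiples r"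
    by (auto simp: congruence_graph_def multiples_def one)
  show "subgroup (congruence_graph r H \<phi>) (G \<times>\<times> integer_group)"
  proof (rule group.subgroupI[OF group_times_integer])
    show "congruence_graph r H \<phi> \<subseteq> carrier (G \<times>\<times> integer_group)"
      by (auto simp: congruence_graph_def)
    have "(\<one>, 0) \<in> congruence_graph r H \<phi>"
      by (simp add: congruence_graph_def one)
    then show "congruence_graph r H \<phi> \<noteq> {}" by blast
  next
    fix a assume "a \<in> congruence_graph r H \<phi>"
    then show "inv\<^bsub>G \<times>\<times> integer_group\<^esub> a \<in> congruence_graph r H \<phi>"
      by (auto simp: congruence_graph_def is_group neg)
  next
    fix a b assume "a \<in> congruence_graph r H \<phi>" "b \<in> congruence_graph r H \<phi>"
    then show "a \<otimes>\<^bsub>G \<times>\<times> integer_group\<^esub> b \<in> congruence_graph r H \<phi>"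
      by (auto simp: congruence_graph_def mult) (metis mod_add_eq)
  qed
qed

text \<open>
  Two elements of \<open>K\<close> with the same first component differ by an element \<open>(\<one>, n)\<close> of \<open>K\<close>, that is, by
  a multiple of \<open>r\<close> in the second component; so the second component modulo \<open>r\<close> is a function of the first.
\<close>
lemma exists_congruence_graph:
  assumes K: "subgroup K (G \<times>\<times> integer_group)" and r: "{n. (\<one>, n) \<in> K} = multiples r" "r > 0"
  obtains \<phi> where "\<phi> \<in> Hom (G\<lparr>carrier := fst ` K\<rparr>) (integer_mod_group r)"
    "K = congruence_graph r (fst ` K) \<phi>"
proof -
  note KD = times_integer_subgroupD[OF K]
  have cong: "(h, n') \<in> K \<longleftrightarrow> n mod int r = n' mod int r" if h: "(h, n) \<in> K" for h n n'
  proof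
    assume "(h, n') \<in> K"
    then have "(h \<otimes> inv h, n + (- n')) \<in> K"
      using h KD(3,4) by blast
    then have "n - n' \<in> {n. (\<one>, n) \<in> K}"
      using KD(1)[OF h] by simp
    then show "n mod int r = n' mod int r"
      unfolding r by (simp add: multiples_def mod_eq_dvd_iff)
  next
    assume "n mod int r = n' mod int r"
    then have "n' - n \<in> {n. (\<one>, n) \<in> K}"
      unfolding r by (simp add: multiples_def flip: mod_eq_dvd_iff)
    then have "(\<one> \<otimes> h, (n' - n) + n) \<in> K"
      using h KD(3) by blast
    then show "(h, n') \<in> K"
      using KD(1)[OF h] by simp
  qed
  have "\<exists>n. (h, n) \<in> K" if "h \<in> fst ` K" for h
    using that by auto
  then obtain s where s: "\<And>h. h \<in> fst ` K \<Longrightarrow> (h, s h) \<in> K"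
    by metis
  define \<phi> where "\<phi> = (\<lambda>h\<in>fst ` K. s h mod int r)"
  have mem: "(h, n) \<in> K \<longleftrightarrow> h \<in> fst ` K \<and> n mod int r = \<phi> h" for h n
  proof (cases "h \<in> fst ` K")
    case True
    then show ?thesis
      using cong[OF s[OF True], of n] by (auto simp: \<phi>_def)
  qed force
  have "\<phi> (h \<otimes> h') = (\<phi> h + \<phi> h') mod int r" if "h \<in> fst ` K" "h' \<in> fst ` K" for h h'
    using KD(3)[OF s[OF that(1)] s[OF that(2)]] that unfolding mem by (simp add: \<phi>_def mod_add_eq)
  then have "\<phi> \<in> Hom (G\<lparr>carrier := fst ` K\<rparr>) (integer_mod_group r)"
    using r(2) by (auto simp: Hom_def hom_def carrier_integer_mod_group \<phi>_def)
  moreover have "K = congruence_graph r (fst ` K) \<phi>"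
    unfolding congruence_graph_def using mem by auto
  ultimately show thesis
    by (rule that)
qed

lemma bij_betw_congruence_graph:
  assumes m: "m \<ge> 1"
  shows "bij_betw (\<lambda>(r, H, \<phi>). congruence_graph r H \<phi>)
    (SIGMA r:{r. r dvd m}. SIGMA H:subgroups_of_index G (m div r).
       Hom (G\<lparr>carrier := H\<rparr>) (integer_mod_group r))
    (subgroups_of_index (G \<times>\<times> integer_group) m)" (is "bij_betw ?\<Phi> ?Y ?X")
proof (rule bij_betw_imageI)
  have pos: "r > 0" if "r dvd m" for r
    using that m by (metis dvd_0_left_iff gr0I not_one_le_zero)
  show "inj_on ?\<Phi> ?Y"
  proof (rule inj_onI)
    fix p p' assume p: "p \<in> ?Y" and p': "p' \<in> ?Y" and "?\<Phi> p = ?\<Phi> p'"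
    obtain r H \<phi> r' H' \<phi>' where pp: "p = (r, H, \<phi>)" "p' = (r', H', \<phi>')"
      by (metis prod_cases3)
    then have r: "r dvd m" "H \<in> subgroups_of_index G (m div r)"
        "\<phi> \<in> Hom (G\<lparr>carrier := H\<rparr>) (integer_mod_group r)"
      and r': "r' dvd m" "H' \<in> subgroups_of_index G (m div r')"
        "\<phi>' \<in> Hom (G\<lparr>carrier := H'\<rparr>) (integer_mod_group r')"
      and eq: "congruence_graph r H \<phi> = congruence_graph r' H' \<phi>'"
      using p p' \<open>?\<Phi> p = ?\<Phi> p'\<close> by auto
    have H: "subgroup H G" "subgroup H' G"
      using r(2) r'(2) by (auto simp: subgroups_of_index_def)
    note D = congruence_graph_subgroup_data(2,3)[OF H(1) pos[OF r(1)] r(3)]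
    note D' = congruence_graph_subgroup_data(2,3)[OF H(2) pos[OF r'(1)] r'(3)]
    have HH: "H = H'" and rr: "r = r'"
      using D D' eq multiples_inj by auto
    have "\<phi> h = \<phi>' h" if h: "h \<in> H" for h
    proof -
      have b: "\<phi> h mod int r = \<phi> h"
        using Hom_mod_groupD(1)[OF r(3) pos[OF r(1)] h] by simp
      then have "(h, \<phi> h) \<in> congruence_graph r' H' \<phi>'"
        unfolding eq[symmetric] using h by (simp add: congruence_graph_def)
      then show ?thesis
        using b by (simp add: congruence_graph_def rr)
    qed
    then have "\<phi> = \<phi>'"
      using r(3) r'(3) by (intro extensionalityI[of _ H]) (auto simp: Hom_def HH)
    then show "p = p'"
      using HH rr pp by simp
  qed
  show "?\<Phi> ` ?Y = ?X"
  proof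
    show "?\<Phi> ` ?Y \<subseteq> ?X"
    proof clarify
      fix r H \<phi>
      assume r: "r dvd m" and H: "H \<in> subgroups_of_index G (m div r)"
        and \<phi>: "\<phi> \<in> Hom (G\<lparr>carrier := H\<rparr>) (integer_mod_group r)"
      have H': "subgroup H G" "card (rcosets H) = m div r"
        using H by (auto simp: subgroups_of_index_def)
      note D = congruence_graph_subgroup_data[OF H'(1) pos[OF r] \<phi>]
      show "congruence_graph r H \<phi> \<in> ?X"
        using D(1) card_rcosets_via_fst[OF D(1)] r H'(2)
        by (simp add: subgroups_of_index_def D(2,3) card_rcosets_multiples)
    qed
    show "?X \<subseteq> ?\<Phi> ` ?Y"
    proof
      fix K assume "K \<in> ?X"
      then have K: "subgroup K (G \<times>\<times> integer_group)" "card (rcosets\<^bsub>G \<times>\<times> integer_group\<^esub> K) = m"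
        by (auto simp: subgroups_of_index_def)
      obtain r where r: "{n. (\<one>, n) \<in> K} = multiples r"
        using subgroup_inter_integers[OF K(1)] .
      have mr: "m = card (rcosets (fst ` K)) * r"
        using card_rcosets_via_fst[OF K(1)] K(2) by (simp add: r card_rcosets_multiples)
      then have "r > 0"
        using m by (cases r) auto
      then obtain \<phi> where \<phi>: "\<phi> \<in> Hom (G\<lparr>carrier := fst ` K\<rparr>) (integer_mod_group r)"
        "K = congruence_graph r (fst ` K) \<phi>"
        using exists_congruence_graph[OF K(1) r] by metis
      have "fst ` K \<in> subgroups_of_index G (m div r)"
        using subgroup_fst_image[OF K(1)] mr \<open>r > 0\<close> by (simp add: subgroups_of_index_def)
      then show "K \<in> ?\<Phi> ` ?Y"
        using \<phi> mr by (intro image_eqI[of _ _ "(r, fst ` K, \<phi>)"]) auto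
    qed
  qed
qed

end

theorem theoremH:
  fixes G :: "('a, 'b) monoid_scheme" and m :: nat
  assumes "group G" and "m \<ge> 1"
  shows "num_subgroups (G \<times>\<times> integer_group) m
           =o (CSUM r : |{r. r dvd m}|. |{..<r}| *c num_subgroup_classes G r)
       \<and> (CSUM r : |{r. r dvd m}|. |{..<r}| *c num_subgroup_classes G r)
           =o (CSUM r : |{r. r dvd m}|. CSUM H : |subgroups_of_index G (m div r)|.
                 |Hom (abelianization (G\<lparr>carrier := H\<rparr>)) (integer_mod_group r)| )"
proof -
  interpret group G by (rule assms)
  let ?X = "subgroups_of_index (G \<times>\<times> integer_group) m"
  let ?Y = "SIGMA r:{r. r dvd m}. {..<r} \<times> subgroup_conj_classes G r"
  let ?Z = "SIGMA r:{r. r dvd m}. SIGMA H:subgroups_of_index G (m div r).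
    Hom (abelianization (G\<lparr>carrier := H\<rparr>)) (integer_mod_group r)"
  let ?X' = "SIGMA r:{r. r dvd m}. SIGMA N:subgroups_of_index G r.
    rcosets\<^bsub>G\<lparr>carrier := normalizer G N\<rparr>\<^esub> N"
  let ?Z' = "SIGMA r:{r. r dvd m}. SIGMA H:subgroups_of_index G (m div r).
    Hom (G\<lparr>carrier := H\<rparr>) (integer_mod_group r)"
  have "|?X| =o |?X'|"
    using bij_betw_subgroups_fibres[OF assms(2)] card_of_ordIso by blast
  also have "|?X'| =o |?Y|"
  proof (rule card_of_Sigma_cong1)
    fix r assume "r \<in> {r. r dvd m}"
    then have "r \<ge> 1"
      using assms(2) by (cases r) auto
    then show "|SIGMA N:subgroups_of_index G r. rcosets\<^bsub>G\<lparr>carrier := normalizer G N\<rparr>\<^esub> N|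
        =o |{..<r} \<times> subgroup_conj_classes G r|"
      by (rule normalizer_cosets_by_conj_classes)
  qed
  finally have XY: "|?X| =o |?Y|" .
  have "|?Z| =o |?Z'|"
  proof (intro card_of_Sigma_cong1)
    fix r H assume "H \<in> subgroups_of_index G (m div r)"
    then have "group (G\<lparr>carrier := H\<rparr>)"
      by (simp add: subgroups_of_index_def subgroup_imp_group)
    from group.bij_betw_Hom_abelianization[OF this abelian_integer_mod_group]
    show "|Hom (abelianization (G\<lparr>carrier := H\<rparr>)) (integer_mod_group r)|
        =o |Hom (G\<lparr>carrier := H\<rparr>) (integer_mod_group r)|"
      using card_of_ordIso by blast
  qed
  also have "|?Z'| =o |?X|"
    using bij_betw_congruence_graph[OF assms(2)] card_of_ordIso by blast
  finally have ZX: "|?Z| =o |?X|" .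
  have Y: "(CSUM r : |{r. r dvd m}|. |{..<r}| *c num_subgroup_classes G r) = |?Y|"
    by (simp add: Csum_def cprod_def num_subgroup_classes_def Field_card_of)
  have Z: "(CSUM r : |{r. r dvd m}|. CSUM H : |subgroups_of_index G (m div r)|.
      |Hom (abelianization (G\<lparr>carrier := H\<rparr>)) (integer_mod_group r)| ) = |?Z|"
    by (simp add: Csum_def Field_card_of)
  show ?thesis
    unfolding Y Z num_subgroups_def
    using XY ZX ordIso_symmetric ordIso_transitive by blast
qed

end
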